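(* Let $n\ge1$ and $d\ge2$ be integers. If $\mathcal{T}\in\mathbb{C}^{n^{2d}}$ is a CPS tensor, then $$\min_{\substack{\mathcal{X}\in\mathbb{C}^{n^{2d}}\ \mathrm{CPS}\\ \operatorname{rank}_{\mathrm{CPS}}(\mathcal{X})=1}}\|\mathcal{T}-\mathcal{X}\|=\min_{\substack{\mathcal{X}\in\mathbb{C}^{n^{2d}}\ \mathrm{PS}\\ \operatorname{rank}_{\mathrm{PS}}(\mathcal{X})=1}}\|\mathcal{T}-\mathcal{X}\|\ge\min_{\substack{\mathcal{X}\in\mathbb{C}^{n^{2d}}\\ \operatorname{rank}(\mathcal{X})=1}}\|\mathcal{T}-\mathcal{X}\|.$$ Moreover, there exists a CPS tensor $\mathcal{T}$ (for some $n$ and some $d\ge2$) such that $$\min_{\substack{\mathcal{X}\in\mathbb{C}^{n^{2d}}\ \mathrm{CPS}\\ \operatorname{rank}_{\mathrm{CPS}}(\mathcal{X})=1}}\|\mathcal{T}-\mathcal{X}\|>\min_{\substack{\mathcal{X}\in\mathbb{C}^{n^{2d}}\\ \operatorname{rank}(\mathcal{X})=1}}\|\mathcal{T}-\mathcal{X}\|.$$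
   Context: $\mathbb{C}^{n^{2d}}$ denotes the space of complex tensors of order $2d$ with every mode of dimension $n$. $\mathcal{T}\in\mathbb{C}^{n^{2d}}$ is partial-symmetric (PS) if its entries are invariant under any permutation of the first $d$ indices and under any permutation of the last $d$ indices. It is conjugate partial-symmetric (CPS) if it is PS and $\mathcal{T}_{i_1\dots i_d i_{d+1}\dots i_{2d}}=\overline{\mathcal{T}_{i_{d+1}\dots i_{2d}i_1\dots i_d}}$ for all indices. $\|\mathcal{T}\|:=\left(\sum|\mathcal{T}_{i_1\dots i_{2d}}|^2\right)^{1/2}$ is the Frobenius norm. $\operatorname{rank}(\mathcal{T})$ is the smallest $r$ such that $\mathcal{T}=\sum_{j=1}^r\boldsymbol{a}_{j1}\otimes\dots\otimes\boldsymbol{a}_{j,2d}$ with $\boldsymbol{a}_{jk}\in\mathbb{C}^n$. For a PS tensor, $\operatorname{rank}_{\mathrm{PS}}(\mathcal{T})$ is the smallest $r$ such that $\mathcal{T}=\sum_{j=1}^r\lambda_j\overline{\boldsymbol{a}_j}^{\otimes d}\otimes\boldsymbol{a}_j^{\otimes d}$ with $\lambda_j\in\mathbb{C}$, $\boldsymbol{a}_j\in\mathbb{C}^n$. For a CPS tensor, $\operatorname{rank}_{\mathrm{CPS}}(\mathcal{T})$ is defined in the same way but with $\lambda_j\in\mathbb{R}$. Here $\boldsymbol{x}^{\otimes d}$ is the outer product of $d$ copies of $\boldsymbol{x}$ and the bar is entrywise conjugation.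
   Formalization: For T = 0 the minima over tensors of rank exactly one do not exist (the infimum 0 is not attained), so each min is stated as an infimum; it is proved to be attained, hence a true minimum, for every nonzero CPS tensor T. *)

theory Defs
  imports Complex_Main "HOL-Library.Extended_Nat" "HOL-Combinatorics.Permutations"
begin

text \<open>Indices are 0-based. A tensor of order \<open>m\<close> with all modes of dimension \<open>n\<close> is a function on
  index lists of length \<open>m\<close> with entries below \<open>n\<close>, extended by \<open>0\<close> to all other lists, so that
  equality of tensors is equality of functions. A vector of dimension \<open>n\<close> is a function of which
  only the values on \<open>{..<n}\<close> are used.\<close>

type_synonym tensor = "nat list \<Rightarrow> complex"

definition multi_indices :: "nat \<Rightarrow> nat \<Rightarrow> nat list set" where
  "multi_indices n m = {ix. length ix = m \<and> set ix \<subseteq> {..<n}}"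

definition tensors :: "nat \<Rightarrow> nat \<Rightarrow> tensor set" where
  "tensors n m = {T. \<forall>ix. ix \<notin> multi_indices n m \<longrightarrow> T ix = 0}"

definition ps_tensors :: "nat \<Rightarrow> nat \<Rightarrow> tensor set" where
  "ps_tensors n d = {T \<in> tensors n (2 * d). \<forall>ix \<in> multi_indices n (2 * d). \<forall>p.
      p permutes {..<d} \<or> p permutes {d..<2 * d} \<longrightarrow> T (permute_list p ix) = T ix}"

definition cps_tensors :: "nat \<Rightarrow> nat \<Rightarrow> tensor set" where
  "cps_tensors n d = {T \<in> ps_tensors n d. \<forall>ix \<in> multi_indices n (2 * d).
      T ix = cnj (T (drop d ix @ take d ix))}"

definition frob_norm :: "nat \<Rightarrow> nat \<Rightarrow> tensor \<Rightarrow> real" where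
  "frob_norm n m T = sqrt (\<Sum>ix \<in> multi_indices n m. (cmod (T ix))\<^sup>2)"

definition outer_prod :: "nat \<Rightarrow> nat \<Rightarrow> (nat \<Rightarrow> nat \<Rightarrow> complex) \<Rightarrow> tensor" where
  "outer_prod n m a = (\<lambda>ix. if ix \<in> multi_indices n m then \<Prod>k<m. a k (ix ! k) else 0)"

definition conj_power :: "nat \<Rightarrow> nat \<Rightarrow> (nat \<Rightarrow> complex) \<Rightarrow> tensor" where
  "conj_power n d x = outer_prod n (2 * d) (\<lambda>k i. if k < d then cnj (x i) else x i)"

text \<open>The ranks take values in \<^typ>\<open>enat\<close>: the infimum of a nonempty set is its least element, and
  a tensor without a decomposition of the required form would have rank \<open>\<infinity>\<close>.\<close>

definition tensor_rank :: "nat \<Rightarrow> nat \<Rightarrow> tensor \<Rightarrow> enat" where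
  "tensor_rank n m T = Inf {enat r | r. \<exists>a :: nat \<Rightarrow> nat \<Rightarrow> nat \<Rightarrow> complex.
      T = (\<lambda>ix. \<Sum>j<r. outer_prod n m (a j) ix)}"

definition rank_ps :: "nat \<Rightarrow> nat \<Rightarrow> tensor \<Rightarrow> enat" where
  "rank_ps n d T = Inf {enat r | r. \<exists>(l :: nat \<Rightarrow> complex) (a :: nat \<Rightarrow> nat \<Rightarrow> complex).
      T = (\<lambda>ix. \<Sum>j<r. l j * conj_power n d (a j) ix)}"

definition rank_cps :: "nat \<Rightarrow> nat \<Rightarrow> tensor \<Rightarrow> enat" where
  "rank_cps n d T = Inf {enat r | r. \<exists>(l :: nat \<Rightarrow> real) (a :: nat \<Rightarrow> nat \<Rightarrow> complex).
      T = (\<lambda>ix. \<Sum>j<r. complex_of_real (l j) * conj_power n d (a j) ix)}"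

definition rank_one :: "nat \<Rightarrow> nat \<Rightarrow> tensor set" where
  "rank_one n m = {X \<in> tensors n m. tensor_rank n m X = 1}"

definition ps_rank_one :: "nat \<Rightarrow> nat \<Rightarrow> tensor set" where
  "ps_rank_one n d = {X \<in> ps_tensors n d. rank_ps n d X = 1}"

definition cps_rank_one :: "nat \<Rightarrow> nat \<Rightarrow> tensor set" where
  "cps_rank_one n d = {X \<in> cps_tensors n d. rank_cps n d X = 1}"

text \<open>For \<open>n \<ge> 1\<close> the zero tensor has no nearest tensor of rank exactly one (the distances have
  infimum \<open>0\<close>, which is not attained). The minimal distance is therefore defined as an infimum,
  and that it is attained, i.e. is a minimum, is a separate predicate.\<close>

definition min_dist :: "nat \<Rightarrow> nat \<Rightarrow> tensor \<Rightarrow> tensor set \<Rightarrow> real" where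
  "min_dist n m T S = (INF X \<in> S. frob_norm n m (T - X))"

definition min_attained :: "nat \<Rightarrow> nat \<Rightarrow> tensor \<Rightarrow> tensor set \<Rightarrow> bool" where
  "min_attained n m T S \<longleftrightarrow> (\<exists>X \<in> S. frob_norm n m (T - X) = min_dist n m T S)"

end

(* The reduction from PS to CPS rests on the symmetry of T under conjugation combined with the
   exchange of the two index halves: replacing the coefficient of a rank-one PS tensor by its real
   part does not increase the distance to T.

   The minimum over tensors of rank exactly one is attained once some such tensor is closer to T
   than 0 is: factors of sup norm 1 and bounded coefficients form a compact set, and the minimizer
   over it cannot be 0. A closer tensor is the projection of T onto the power of a vector x at which
   the form of T does not vanish, and such an x exists by a Kronecker substitution.

   The gap is shown by the tensor of order 4 and dimension 2 with entries 1 at 0011 and 1100: it has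
   distance 1 to a tensor of rank one, and squared distance at least 4/3 to any CPS one. *)

theory Submission
  imports Defs "HOL-Analysis.Analysis"
begin

section \<open>Multi-indices and tensors of rank one\<close>

abbreviation swap_halves :: "nat \<Rightarrow> nat list \<Rightarrow> nat list" where
  "swap_halves d ix \<equiv> drop d ix @ take d ix"

lemma finite_multi_indices [simp]: "finite (multi_indices n m)"
  using finite_lists_length_eq[of "{..<n}" m] by (simp add: multi_indices_def conj_commute)

lemma multi_indices_nth: "ix \<in> multi_indices n m \<Longrightarrow> k < m \<Longrightarrow> ix ! k < n"
  by (auto simp: multi_indices_def subset_iff)

lemma swap_halves_in: "ix \<in> multi_indices n (2 * d) \<Longrightarrow> swap_halves d ix \<in> multi_indices n (2 * d)"
  by (auto simp: multi_indices_def dest: in_set_takeD in_set_dropD)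

lemma swap_halves_swap: "ix \<in> multi_indices n (2 * d) \<Longrightarrow> swap_halves d (swap_halves d ix) = ix"
  by (auto simp: multi_indices_def)

lemma sum_swap_halves:
  "(\<Sum>ix\<in>multi_indices n (2 * d). f (swap_halves d ix)) = (\<Sum>ix\<in>multi_indices n (2 * d). f ix)"
  by (rule sum.reindex_bij_witness[of _ "swap_halves d" "swap_halves d"])
     (simp_all only: swap_halves_in swap_halves_swap)

lemma permute_list_in_multi_indices:
  assumes "p permutes {..<m}" "ix \<in> multi_indices n m"
  shows "permute_list p ix \<in> multi_indices n m"
  using assms by (auto simp: multi_indices_def)

text \<open>The infimum of a nonempty set of extended naturals is one of its members. For each of
  the three ranks, \<open>Q 0\<close> says that the tensor is the empty sum, that is, zero.\<close>

lemma Inf_enat_eq_1_iff: "Inf {enat r | r. Q r} = 1 \<longleftrightarrow> \<not> Q 0 \<and> Q 1"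
proof
  assume *: "Inf {enat r | r. Q r} = 1"
  then have "{enat r | r. Q r} \<noteq> {}"
    by (metis Inf_empty infinity_ne_i1 top_enat_def)
  then have "Inf {enat r | r. Q r} \<in> {enat r | r. Q r}"
    by (auto simp: Inf_enat_def intro: LeastI)
  then have "Q 1"
    using * by (auto simp: one_enat_def)
  moreover have "\<not> Q 0"
  proof
    assume "Q 0"
    then have "Inf {enat r | r. Q r} \<le> enat 0"
      by (intro Inf_lower) auto
    then show False
      using * by (simp add: one_enat_def)
  qed
  ultimately show "\<not> Q 0 \<and> Q 1" by simp
next
  assume *: "\<not> Q 0 \<and> Q 1"
  show "Inf {enat r | r. Q r} = 1"
  proof (rule antisym)
    show "Inf {enat r | r. Q r} \<le> 1"
      using * by (intro Inf_lower) (auto simp: one_enat_def)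
    show "1 \<le> Inf {enat r | r. Q r}"
    proof (rule Inf_greatest)
      fix e assume "e \<in> {enat r | r. Q r}"
      then obtain r where "e = enat r" "Q r" by auto
      with * show "1 \<le> e"
        by (cases r) (auto simp: one_enat_def)
    qed
  qed
qed

lemma rank_one_iff:
  "X \<in> rank_one n m \<longleftrightarrow> X \<noteq> (\<lambda>_. 0) \<and> (\<exists>a. X = outer_prod n m a)"
proof -
  have "(\<exists>a :: nat \<Rightarrow> nat \<Rightarrow> nat \<Rightarrow> complex. X = (\<lambda>ix. \<Sum>j<1. outer_prod n m (a j) ix)) \<longleftrightarrow>
      (\<exists>a. X = outer_prod n m a)"
  proof safe
    fix a
    show "\<exists>a' :: nat \<Rightarrow> nat \<Rightarrow> nat \<Rightarrow> complex.
        outer_prod n m a = (\<lambda>ix. \<Sum>j<1. outer_prod n m (a' j) ix)"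
      by (intro exI[of _ "\<lambda>_. a"]) auto
  qed auto
  then show ?thesis
    unfolding rank_one_def tensor_rank_def Inf_enat_eq_1_iff
    by (auto simp: tensors_def outer_prod_def)
qed

section \<open>Symmetries of conjugate powers and explicit rank-one sets\<close>

lemma conj_power_eq:
  assumes "ix \<in> multi_indices n (2 * d)"
  shows "conj_power n d x ix = cnj (\<Prod>k<d. x (ix ! k)) * (\<Prod>k<d. x (ix ! (d + k)))"
proof -
  have "conj_power n d x ix = (\<Prod>k<d + d. if k < d then cnj (x (ix ! k)) else x (ix ! k))"
    using assms by (simp add: conj_power_def outer_prod_def mult_2)
  also have "\<dots> = (\<Prod>k<d. cnj (x (ix ! k))) * (\<Prod>k<d. x (ix ! (d + k)))"
    using prod.atLeastLessThan_concat[of 0 d "d + d" "\<lambda>k. if k < d then cnj (x (ix ! k)) else x (ix ! k)"]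
      prod.shift_bounds_nat_ivl[of "\<lambda>k. x (ix ! k)" 0 d d]
    by (simp add: lessThan_atLeast0 add.commute)
  finally show ?thesis
    by simp
qed

lemma conj_power_outside: "ix \<notin> multi_indices n (2 * d) \<Longrightarrow> conj_power n d x ix = 0"
  by (simp add: conj_power_def outer_prod_def)

lemma conj_power_swap:
  assumes "ix \<in> multi_indices n (2 * d)"
  shows "conj_power n d x (swap_halves d ix) = cnj (conj_power n d x ix)"
proof -
  have len: "length ix = 2 * d"
    using assms by (simp add: multi_indices_def)
  have "(\<Prod>k<d. x (swap_halves d ix ! k)) = (\<Prod>k<d. x (ix ! (d + k)))"
    using len by (intro prod.cong) (auto simp: nth_append)
  moreover have "(\<Prod>k<d. x (swap_halves d ix ! (d + k))) = (\<Prod>k<d. x (ix ! k))"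
    using len by (intro prod.cong) (auto simp: nth_append)
  ultimately show ?thesis
    by (simp only: conj_power_eq[OF assms] conj_power_eq[OF swap_halves_in[OF assms]]) simp
qed

lemma conj_power_permute:
  assumes ix: "ix \<in> multi_indices n (2 * d)" and p: "p permutes {..<d} \<or> p permutes {d..<2 * d}"
  shows "conj_power n d x (permute_list p ix) = conj_power n d x ix"
proof -
  have p2: "p permutes {..<2 * d}"
    using p by (auto intro: permutes_subset)
  have len: "length ix = 2 * d"
    using ix by (simp add: multi_indices_def)
  have nth: "permute_list p ix ! k = ix ! p k" if "k < 2 * d" for k
    using that p2 len by (simp add: permute_list_nth)
  let ?y = "\<lambda>k. if k < d then cnj (x (ix ! k)) else x (ix ! k)"
  \<comment> \<open>A permutation inside one half keeps every position in its half, so conjugated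
    factors stay conjugated and the product is only reordered.\<close>
  have side: "p k < d \<longleftrightarrow> k < d" if "k < 2 * d" for k
    using p
  proof
    assume "p permutes {..<d}"
    then show ?thesis
      using permutes_in_image[of p "{..<d}" k] by simp
  next
    assume "p permutes {d..<2 * d}"
    then have "p k \<in> {d..<2 * d} \<longleftrightarrow> k \<in> {d..<2 * d}"
      by (rule permutes_in_image)
    moreover have "p k < 2 * d"
      using permutes_in_image[OF p2, of k] that by simp
    ultimately show ?thesis
      using that by auto
  qed
  have "conj_power n d x (permute_list p ix) = (\<Prod>k<2 * d. ?y (p k))"
    using permute_list_in_multi_indices[OF p2 ix] nth side
    by (auto simp: conj_power_def outer_prod_def intro!: prod.cong)
  also have "\<dots> = (\<Prod>k<2 * d. ?y k)"
    using prod.permute[OF p2, of ?y] by (simp add: o_def)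
  also have "\<dots> = conj_power n d x ix"
    using ix by (auto simp: conj_power_def outer_prod_def intro!: prod.cong)
  finally show ?thesis .
qed

lemma scaled_conj_power_ps: "(\<lambda>ix. l * conj_power n d x ix) \<in> ps_tensors n d"
  by (auto simp: ps_tensors_def tensors_def conj_power_outside conj_power_permute)

text \<open>Exchanging the halves conjugates the power, and a real coefficient equals its own
  conjugate.\<close>

lemma scaled_conj_power_cps: "(\<lambda>ix. complex_of_real l * conj_power n d x ix) \<in> cps_tensors n d"
  by (auto simp: cps_tensors_def scaled_conj_power_ps conj_power_swap)

lemma ps_rank_one_iff:
  "X \<in> ps_rank_one n d \<longleftrightarrow> X \<noteq> (\<lambda>_. 0) \<and> (\<exists>l x. X = (\<lambda>ix. l * conj_power n d x ix))"
proof -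
  have "(\<exists>(l :: nat \<Rightarrow> complex) a. X = (\<lambda>ix. \<Sum>j<1. l j * conj_power n d (a j) ix)) \<longleftrightarrow>
      (\<exists>l x. X = (\<lambda>ix. l * conj_power n d x ix))"
  proof safe
    fix l x
    show "\<exists>(l' :: nat \<Rightarrow> complex) a.
        (\<lambda>ix. l * conj_power n d x ix) = (\<lambda>ix. \<Sum>j<1. l' j * conj_power n d (a j) ix)"
      by (intro exI[of _ "\<lambda>_. l"] exI[of _ "\<lambda>_. x"]) auto
  qed auto
  then show ?thesis
    unfolding ps_rank_one_def rank_ps_def Inf_enat_eq_1_iff
    by (auto simp: scaled_conj_power_ps)
qed

lemma cps_rank_one_iff:
  "X \<in> cps_rank_one n d \<longleftrightarrow>
    X \<noteq> (\<lambda>_. 0) \<and> (\<exists>l x. X = (\<lambda>ix. complex_of_real l * conj_power n d x ix))"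
proof -
  have "(\<exists>(l :: nat \<Rightarrow> real) a. X = (\<lambda>ix. \<Sum>j<1. complex_of_real (l j) * conj_power n d (a j) ix)) \<longleftrightarrow>
      (\<exists>l x. X = (\<lambda>ix. complex_of_real l * conj_power n d x ix))"
  proof safe
    fix l x
    show "\<exists>(l' :: nat \<Rightarrow> real) a. (\<lambda>ix. complex_of_real l * conj_power n d x ix) =
        (\<lambda>ix. \<Sum>j<1. complex_of_real (l' j) * conj_power n d (a j) ix)"
      by (intro exI[of _ "\<lambda>_. l"] exI[of _ "\<lambda>_. x"]) auto
  qed auto
  then show ?thesis
    unfolding cps_rank_one_def rank_cps_def Inf_enat_eq_1_iff
    by (auto simp: scaled_conj_power_cps)
qed

lemma cps_rank_one_subset: "cps_rank_one n d \<subseteq> ps_rank_one n d"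
  unfolding cps_rank_one_iff ps_rank_one_iff subset_iff by blast

text \<open>The scalar goes into the factor of mode 0, which exists because
  \<open>m \<ge> 1\<close>.\<close>

lemma scaled_outer_prod:
  assumes "m \<ge> 1"
  shows "(\<lambda>ix. l * outer_prod n m a ix) = outer_prod n m (a(0 := (\<lambda>i. l * a 0 i)))"
proof
  fix ix
  obtain m' where "m = Suc m'" using assms by (cases m) auto
  then show "l * outer_prod n m a ix = outer_prod n m (a(0 := (\<lambda>i. l * a 0 i))) ix"
    by (simp add: outer_prod_def prod.lessThan_Suc_shift mult.assoc del: prod.lessThan_Suc)
qed

lemma ps_rank_one_subset:
  assumes "d \<ge> 1"
  shows "ps_rank_one n d \<subseteq> rank_one n (2 * d)"
  using assms
  by (auto simp: ps_rank_one_iff rank_one_iff conj_power_def scaled_outer_prod)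

text \<open>Comparing infima needs a nonempty set of competitors; the all-ones vector supplies
  one.\<close>

lemma cps_rank_one_nonempty:
  assumes "n \<ge> 1"
  shows "cps_rank_one n d \<noteq> {}"
proof -
  let ?X = "\<lambda>ix. complex_of_real 1 * conj_power n d (\<lambda>_. 1) ix"
  have "replicate (2 * d) 0 \<in> multi_indices n (2 * d)"
    using assms by (auto simp: multi_indices_def)
  then have "?X (replicate (2 * d) 0) \<noteq> 0"
    by (simp add: conj_power_eq)
  then have "?X \<noteq> (\<lambda>_. 0)"
    by metis
  then have "?X \<in> cps_rank_one n d"
    unfolding cps_rank_one_iff by blast
  then show ?thesis by blast
qed

section \<open>Distances\<close>

lemma frob_norm_nonneg: "frob_norm n m T \<ge> 0"
  by (simp add: frob_norm_def sum_nonneg)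

lemma cmod_le_frob_norm: "ix \<in> multi_indices n m \<Longrightarrow> cmod (T ix) \<le> frob_norm n m T"
  unfolding frob_norm_def
  by (rule real_le_rsqrt) (rule member_le_sum, auto)

lemma min_dist_le: "X \<in> S \<Longrightarrow> min_dist n m T S \<le> frob_norm n m (T - X)"
  unfolding min_dist_def
  by (rule cINF_lower) (auto intro: bdd_belowI2 frob_norm_nonneg)

lemma min_dist_mono: "S \<subseteq> S' \<Longrightarrow> S \<noteq> {} \<Longrightarrow> min_dist n m T S' \<le> min_dist n m T S"
  unfolding min_dist_def
  by (rule cINF_superset_mono) (auto intro: bdd_belowI2 frob_norm_nonneg)

text \<open>The distance to a family member is unchanged when its coefficient is conjugated, by the
  symmetry exchanging the two halves of the indices; the parallelogram law for a number and its
  conjugate then shows that dropping the imaginary part does not increase the distance.\<close>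

lemma frob_norm_Re_coefficient_le:
  assumes "T \<in> cps_tensors n d"
  shows "frob_norm n (2 * d) (T - (\<lambda>ix. complex_of_real (Re l) * conj_power n d x ix))
    \<le> frob_norm n (2 * d) (T - (\<lambda>ix. l * conj_power n d x ix))"
proof -
  let ?I = "multi_indices n (2 * d)" and ?P = "conj_power n d x"
  define D where "D c = (\<Sum>ix\<in>?I. (cmod (T ix - c * ?P ix))\<^sup>2)" for c
  have T: "T (swap_halves d ix) = cnj (T ix)" if "ix \<in> ?I" for ix
    using assms that unfolding cps_tensors_def by fastforce
  have "D l = (\<Sum>ix\<in>?I. (cmod (T (swap_halves d ix) - l * ?P (swap_halves d ix)))\<^sup>2)"
    unfolding D_def by (rule sum_swap_halves[symmetric])
  also have "\<dots> = (\<Sum>ix\<in>?I. (cmod (cnj (T ix - cnj l * ?P ix)))\<^sup>2)"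
    by (intro sum.cong refl) (simp only: T conj_power_swap, simp)
  also have "\<dots> = D (cnj l)"
    by (simp only: complex_mod_cnj D_def)
  finally have sym: "D l = D (cnj l)" .
  have pt: "2 * (cmod (t - of_real (Re l) * p))\<^sup>2 \<le> (cmod (t - l * p))\<^sup>2 + (cmod (t - cnj l * p))\<^sup>2"
    for t p
  proof -
    have "(cmod (t - l * p))\<^sup>2 + (cmod (t - cnj l * p))\<^sup>2
        = 2 * (cmod (t - of_real (Re l) * p))\<^sup>2 + 2 * ((Im l)\<^sup>2 * (cmod p)\<^sup>2)"
      unfolding cmod_power2 by (simp add: power2_eq_square algebra_simps)
    then show ?thesis by simp
  qed
  have "2 * D (of_real (Re l)) \<le> D l + D (cnj l)"
    unfolding D_def sum_distrib_left sum.distrib[symmetric] by (intro sum_mono pt)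
  then have "D (of_real (Re l)) \<le> D l"
    using sym by simp
  then show ?thesis
    by (simp add: frob_norm_def D_def)
qed

text \<open>A vanishing coefficient is not of rank one; it is reached as a limit.\<close>

lemma min_dist_cps_le:
  "min_dist n (2 * d) T (cps_rank_one n d)
    \<le> frob_norm n (2 * d) (T - (\<lambda>ix. complex_of_real t * conj_power n d x ix))"
  if "conj_power n d x \<noteq> (\<lambda>_. 0)"
proof -
  let ?g = "\<lambda>t. frob_norm n (2 * d) (T - (\<lambda>ix. complex_of_real t * conj_power n d x ix))"
  have ne: "min_dist n (2 * d) T (cps_rank_one n d) \<le> ?g t" if "t \<noteq> 0" for t
  proof (rule min_dist_le)
    obtain ix where "conj_power n d x ix \<noteq> 0"
      using \<open>conj_power n d x \<noteq> (\<lambda>_. 0)\<close> by auto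
    then have "(\<lambda>ix. complex_of_real t * conj_power n d x ix) \<noteq> (\<lambda>_. 0)"
      using that by (metis mult_eq_0_iff of_real_eq_0_iff)
    then show "(\<lambda>ix. complex_of_real t * conj_power n d x ix) \<in> cps_rank_one n d"
      unfolding cps_rank_one_iff by blast
  qed
  have "isCont ?g 0"
    unfolding frob_norm_def fun_diff_def by (intro continuous_intros)
  then have lim: "(?g \<longlongrightarrow> ?g 0) (at 0)"
    by (simp only: isCont_def)
  \<comment> \<open>The filter \<open>at 0\<close> omits the point 0, so the bound for nonzero
    coefficients suffices.\<close>
  have ev: "eventually (\<lambda>t. min_dist n (2 * d) T (cps_rank_one n d) \<le> ?g t) (at 0)"
    unfolding eventually_at_filter by (intro always_eventually) (use ne in auto)
  have "min_dist n (2 * d) T (cps_rank_one n d) \<le> ?g 0"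
    by (rule tendsto_lowerbound[OF lim ev]) simp
  with ne show ?thesis
    by (cases "t = 0") auto
qed

text \<open>One direction is inclusion. For the other, the real part of the coefficient of a PS
  competitor gives no larger distance, and \<open>min_dist_cps_le\<close> also covers a real part
  equal to 0.\<close>

lemma min_dist_cps_eq_ps:
  assumes "n \<ge> 1" "T \<in> cps_tensors n d"
  shows "min_dist n (2 * d) T (cps_rank_one n d) = min_dist n (2 * d) T (ps_rank_one n d)"
proof (rule antisym)
  show "min_dist n (2 * d) T (ps_rank_one n d) \<le> min_dist n (2 * d) T (cps_rank_one n d)"
    using cps_rank_one_subset cps_rank_one_nonempty[OF assms(1)] by (rule min_dist_mono)
  show "min_dist n (2 * d) T (cps_rank_one n d) \<le> min_dist n (2 * d) T (ps_rank_one n d)"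
    unfolding min_dist_def[of _ _ _ "ps_rank_one n d"]
  proof (rule cINF_greatest)
    show "ps_rank_one n d \<noteq> {}"
      using cps_rank_one_subset cps_rank_one_nonempty[OF assms(1)] by blast
    fix X assume "X \<in> ps_rank_one n d"
    then obtain l x where X: "X \<noteq> (\<lambda>_. 0)" "X = (\<lambda>ix. l * conj_power n d x ix)"
      by (auto simp: ps_rank_one_iff)
    then have "conj_power n d x \<noteq> (\<lambda>_. 0)" by auto
    from min_dist_cps_le[OF this] frob_norm_Re_coefficient_le[OF assms(2)]
    show "min_dist n (2 * d) T (cps_rank_one n d) \<le> frob_norm n (2 * d) (T - X)"
      unfolding X(2) by (rule order_trans)
  qed
qed

section \<open>The form of a nonzero tensor does not vanish\<close>

text \<open>A polynomial with infinitely many roots is zero. Several indices may share an exponent,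
  so a coefficient of the polynomial is a sum of values of \<open>c\<close>.\<close>

lemma sum_coefficients_eq_0:
  fixes c :: "'a \<Rightarrow> complex"
  assumes "finite I" "infinite Z" "\<And>z. z \<in> Z \<Longrightarrow> (\<Sum>i\<in>I. c i * z ^ e i) = 0"
  shows "(\<Sum>i | i \<in> I \<and> e i = k. c i) = 0"
proof -
  define p where "p = (\<Sum>i\<in>I. monom (c i) (e i))"
  have "Z \<subseteq> {z. poly p z = 0}"
    using assms(3) by (auto simp: p_def poly_sum poly_monom)
  then have "p = 0"
    using assms(2) poly_roots_finite finite_subset by blast
  then have "0 = coeff p k" by simp
  also have "\<dots> = (\<Sum>i\<in>I. if e i = k then c i else 0)"
    by (simp add: p_def coeff_sum)
  also have "\<dots> = (\<Sum>i | i \<in> I \<and> e i = k. c i)"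
    using assms(1) by (simp add: sum.inter_filter)
  finally show ?thesis by simp
qed

text \<open>In polar coordinates \<open>z = r w\<close> a monomial is \<open>r ^ (a + b)\<close> times \<open>w ^ a * cnj w ^ b\<close>, and
  on the unit circle multiplying the latter by \<open>w ^ (a + b)\<close> gives \<open>w ^ (2 * a)\<close>.\<close>

lemma sum_coefficients_cnj_eq_0:
  fixes c :: "'a \<Rightarrow> complex"
  assumes "finite I" and zero: "\<And>z. (\<Sum>i\<in>I. c i * (z ^ a i * cnj z ^ b i)) = 0"
  shows "(\<Sum>i | i \<in> I \<and> a i = p \<and> b i = q. c i) = 0"
proof -
  \<comment> \<open>Varying the radius isolates the total degree \<open>p + q\<close>; varying the
    angle then isolates \<open>a i\<close>, and with it \<open>b i\<close>.\<close>
  let ?J = "{i \<in> I. a i + b i = p + q}"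
  have "(\<Sum>i\<in>?J. c i * w ^ (2 * a i)) = 0" if w: "w \<in> sphere 0 1" for w
  proof -
    have inf: "infinite (range complex_of_real)"
      by (simp add: finite_image_iff inj_of_real infinite_UNIV_char_0)
    have "(\<Sum>i | i \<in> I \<and> a i + b i = p + q. c i * (w ^ a i * cnj w ^ b i)) = 0"
    proof (rule sum_coefficients_eq_0[OF assms(1) inf])
      fix z assume "z \<in> range complex_of_real"
      then obtain r where "z = complex_of_real r" by auto
      then have "(\<Sum>i\<in>I. c i * (w ^ a i * cnj w ^ b i) * z ^ (a i + b i))
          = (\<Sum>i\<in>I. c i * ((z * w) ^ a i * cnj (z * w) ^ b i))"
        by (intro sum.cong refl) (simp add: power_add power_mult_distrib)
      then show "(\<Sum>i\<in>I. c i * (w ^ a i * cnj w ^ b i) * z ^ (a i + b i)) = 0"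
        by (simp only: zero)
    qed
    then have "0 = w ^ (p + q) * (\<Sum>i\<in>?J. c i * (w ^ a i * cnj w ^ b i))"
      by simp
    also have "\<dots> = (\<Sum>i\<in>?J. c i * w ^ (2 * a i))"
      unfolding sum_distrib_left
    proof (intro sum.cong refl)
      fix i assume "i \<in> ?J"
      then have ab: "a i + b i = p + q" by simp
      have "w * cnj w = 1"
        using w by (simp add: complex_norm_square[symmetric])
      then have "w ^ b i * cnj w ^ b i = 1"
        by (simp flip: power_mult_distrib)
      moreover have "w ^ (p + q) * (c i * (w ^ a i * cnj w ^ b i))
          = c i * (w ^ a i * w ^ a i) * (w ^ b i * cnj w ^ b i)"
        unfolding ab[symmetric] by (simp add: power_add)
      ultimately show "w ^ (p + q) * (c i * (w ^ a i * cnj w ^ b i)) = c i * w ^ (2 * a i)"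
        by (simp add: mult_2 power_add)
    qed
    finally show ?thesis by simp
  qed
  moreover have "infinite (sphere (0 :: complex) 1)"
  proof
    let ?h = "\<lambda>a. Complex a (sqrt (1 - a\<^sup>2))"
    assume "finite (sphere (0 :: complex) 1)"
    moreover have "?h ` {0..1} \<subseteq> sphere 0 1"
      by (auto simp: cmod_def power_le_one)
    ultimately have "finite (?h ` {0..1})"
      by (rule finite_subset[rotated])
    then have "finite {0..1 :: real}"
      by (rule finite_imageD) (simp add: inj_on_def)
    then show False
      by (simp add: infinite_Icc)
  qed
  ultimately have "(\<Sum>i | i \<in> ?J \<and> 2 * a i = 2 * p. c i) = 0"
    using assms(1) by (intro sum_coefficients_eq_0[of ?J "sphere 0 1" c "\<lambda>i. 2 * a i"]) auto
  moreover have "{i. i \<in> ?J \<and> 2 * a i = 2 * p} = {i. i \<in> I \<and> a i = p \<and> b i = q}"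
    by auto
  ultimately show ?thesis by simp
qed

section \<open>Recovering a multiset from a sum of powers\<close>

lemma digits_unique:
  fixes f g :: "nat \<Rightarrow> nat"
  assumes "\<And>i. f i < M" "\<And>i. g i < M" "(\<Sum>i<n. f i * M ^ i) = (\<Sum>i<n. g i * M ^ i)" "i < n"
  shows "f i = g i"
  using assms
proof (induction n arbitrary: f g i)
  case (Suc n)
  have shift: "(\<Sum>i<Suc n. h i * M ^ i) = h 0 + M * (\<Sum>i<n. h (Suc i) * M ^ i)" for h
    by (simp add: sum.lessThan_Suc_shift sum_distrib_left algebra_simps del: sum.lessThan_Suc)
  have eq: "f 0 + M * (\<Sum>i<n. f (Suc i) * M ^ i) = g 0 + M * (\<Sum>i<n. g (Suc i) * M ^ i)"
    using Suc.prems(3) by (simp only: shift)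
  have M: "M > 0"
    using Suc.prems(1)[of 0] by simp
  \<comment> \<open>Reduction modulo \<open>M\<close> isolates the lowest digit; cancelling it and
    the factor \<open>M\<close> leaves one digit fewer.\<close>
  from arg_cong[OF eq, of "\<lambda>s. s mod M"] have f0: "f 0 = g 0"
    using Suc.prems(1,2) by simp
  then have "(\<Sum>i<n. f (Suc i) * M ^ i) = (\<Sum>i<n. g (Suc i) * M ^ i)"
    using eq M by simp
  then have "f (Suc j) = g (Suc j)" if "j < n" for j
    using Suc.IH[of "\<lambda>i. f (Suc i)" "\<lambda>i. g (Suc i)" j] Suc.prems(1,2) that by blast
  with f0 Suc.prems(4) show ?case
    by (cases i) auto
qed simp

text \<open>Collecting equal summands gives an expansion in base \<open>M\<close> whose digits are
  the multiplicities. These are at most the length of the list, hence below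
  \<open>M\<close>.\<close>

lemma mset_eq_if_power_sums_eq:
  fixes u v :: "nat list"
  assumes "length u < M" "length v < M" "(\<Sum>i\<leftarrow>u. M ^ i) = (\<Sum>i\<leftarrow>v. M ^ i)"
  shows "mset u = mset v"
proof (rule multiset_eqI)
  fix i
  obtain n where n: "set u \<union> set v \<union> {i} \<subseteq> {..<n}"
    using finite_nat_iff_bounded[of "set u \<union> set v \<union> {i}"] by auto
  have "(\<Sum>i<n. count_list u i * M ^ i) = (\<Sum>i<n. count_list v i * M ^ i)"
    using assms(3) sum_list_map_eq_sum_count2[of u "{..<n}" "\<lambda>i. M ^ i"]
      sum_list_map_eq_sum_count2[of v "{..<n}" "\<lambda>i. M ^ i"] n by simp
  moreover have "count_list u j < M" "count_list v j < M" for j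
    using assms(1,2) count_le_length[of u j] count_le_length[of v j] by linarith+
  ultimately have "count_list u i = count_list v i"
    using n by (intro digits_unique[of "count_list u" M "count_list v" n]) auto
  then show "count (mset u) i = count (mset v) i"
    by (simp add: count_mset)
qed

section \<open>Entries determined by the multisets of the two halves\<close>

lemma ps_tensor_mset_first:
  assumes T: "T \<in> ps_tensors n d" and len: "length u = d" "length w = d"
    and uw: "u @ w \<in> multi_indices n (2 * d)" and m: "mset u = mset u'"
  shows "T (u' @ w) = T (u @ w)"
proof -
  obtain p where p: "p permutes {..<length u}" "permute_list p u = u'"
    using mset_eq_permutation[of u' u] m by auto
  \<comment> \<open>Beyond the first \<open>d\<close> positions \<open>p\<close> is the identity, so
    it rearranges \<open>u\<close> and leaves \<open>w\<close> in place.\<close>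
  have "permute_list p (u @ w) = u' @ w"
  proof (rule nth_equalityI)
    have len': "length u' = d"
      using m len by (metis size_mset)
    then show "length (permute_list p (u @ w)) = length (u' @ w)"
      using len by simp
    have p2: "p permutes {..<length (u @ w)}"
      using p(1) by (rule permutes_subset) auto
    fix k assume "k < length (permute_list p (u @ w))"
    then have k: "k < length (u @ w)" by simp
    show "permute_list p (u @ w) ! k = (u' @ w) ! k"
    proof (cases "k < d")
      case True
      then have "p k < d"
        using permutes_in_image[OF p(1), of k] len by simp
      moreover have "u' ! k = u ! p k"
        using permute_list_nth[OF p(1), of k] True len p(2) by simp
      ultimately show ?thesis
        using permute_list_nth[OF p2 k] True len len' by (simp add: nth_append)
    next
      case False
      then have "p k = k"
        using permutes_not_in[OF p(1)] len by simp
      then show ?thesis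
        using permute_list_nth[OF p2 k] False len len' by (simp add: nth_append)
    qed
  qed
  then show ?thesis
    using T uw p(1) len unfolding ps_tensors_def by force
qed

text \<open>The first half is rearranged directly. For the second, the CPS symmetry exchanges the
  halves at the cost of a conjugation, which cancels when they are exchanged back.\<close>

lemma cps_tensor_mset:
  assumes T: "T \<in> cps_tensors n d"
    and ix: "ix \<in> multi_indices n (2 * d)" and jx: "jx \<in> multi_indices n (2 * d)"
    and m: "mset (take d ix) = mset (take d jx)" "mset (drop d ix) = mset (drop d jx)"
  shows "T ix = T jx"
proof -
  have ps: "T \<in> ps_tensors n d"
    using T by (simp add: cps_tensors_def)
  have swap: "T kx = cnj (T (swap_halves d kx))" if "kx \<in> multi_indices n (2 * d)" for kx
    using T that unfolding cps_tensors_def by blast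
  have len: "length ix = 2 * d" "length jx = 2 * d"
    using ix jx by (auto simp: multi_indices_def)
  define kx where "kx = take d jx @ drop d ix"
  have kx: "kx \<in> multi_indices n (2 * d)"
    using ix jx by (auto simp: kx_def multi_indices_def dest: in_set_takeD in_set_dropD)
  have "T ix = T kx"
    using ps_tensor_mset_first[OF ps, of "take d ix" "drop d ix" "take d jx"] len ix m
    by (simp add: kx_def)
  moreover have "T (swap_halves d kx) = T (swap_halves d jx)"
    using ps_tensor_mset_first[OF ps, of "drop d ix" "take d jx" "drop d jx"]
      len m swap_halves_in[OF kx] by (simp add: kx_def)
  ultimately show ?thesis
    using swap[OF kx] swap[OF jx] by simp
qed

text \<open>The inner product of \<open>T\<close> with the conjugate power of \<open>x\<close>: a
  polynomial of degree \<open>d\<close> in the entries of \<open>x\<close> and of degree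
  \<open>d\<close> in their conjugates.\<close>

definition form :: "nat \<Rightarrow> nat \<Rightarrow> tensor \<Rightarrow> (nat \<Rightarrow> complex) \<Rightarrow> complex" where
  "form n d T x = (\<Sum>ix\<in>multi_indices n (2 * d). T ix * cnj (conj_power n d x ix))"

text \<open>Exchanging the halves conjugates every summand. This makes the coefficient of the
  projection in \<open>exists_closer_than_zero\<close> real, hence the projection CPS.\<close>

lemma form_real:
  assumes "T \<in> cps_tensors n d"
  shows "form n d T x = complex_of_real (Re (form n d T x))"
proof -
  let ?I = "multi_indices n (2 * d)" and ?P = "conj_power n d x"
  have T: "T (swap_halves d ix) = cnj (T ix)" if "ix \<in> ?I" for ix
    using assms that unfolding cps_tensors_def by fastforce
  have "form n d T x = (\<Sum>ix\<in>?I. T (swap_halves d ix) * cnj (?P (swap_halves d ix)))"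
    unfolding form_def by (rule sum_swap_halves[symmetric])
  also have "\<dots> = (\<Sum>ix\<in>?I. cnj (T ix * cnj (?P ix)))"
    by (intro sum.cong refl) (simp only: T conj_power_swap, simp)
  also have "\<dots> = cnj (form n d T x)"
    by (simp add: form_def)
  finally show ?thesis
    by (simp add: complex_eq_iff)
qed

text \<open>Kronecker substitution \<open>x i = z ^ (M ^ i)\<close> with a base \<open>M\<close> exceeding the degree: distinct
  monomials of the form become distinct monomials in \<open>z\<close> and \<open>cnj z\<close>.\<close>

lemma form_nonzero:
  assumes T: "T \<in> cps_tensors n d" and "T \<noteq> (\<lambda>_. 0)"
  shows "\<exists>x. form n d T x \<noteq> 0"
proof (rule ccontr)
  assume "\<nexists>x. form n d T x \<noteq> 0"
  then have zero: "form n d T x = 0" for x by blast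
  let ?I = "multi_indices n (2 * d)"
  \<comment> \<open>Multiplicities within a half are at most \<open>d\<close>, so they are digits in
    base \<open>Suc d\<close>.\<close>
  define M where "M = Suc d"
  define a where "a ix = (\<Sum>i\<leftarrow>take d ix. M ^ i)" for ix
  define b where "b ix = (\<Sum>i\<leftarrow>drop d ix. M ^ i)" for ix
  have a_eq: "a ix = (\<Sum>k<d. M ^ (ix ! k))" and b_eq: "b ix = (\<Sum>k<d. M ^ (ix ! (d + k)))"
    if "ix \<in> ?I" for ix
    using that
    by (auto simp: a_def b_def multi_indices_def sum_list_sum_nth atLeast0LessThan intro!: sum.cong)
  have "(\<Sum>ix\<in>?I. T ix * (z ^ a ix * cnj z ^ b ix)) = 0" for z
  proof -
    have "form n d T (\<lambda>i. z ^ (M ^ i)) = (\<Sum>ix\<in>?I. T ix * (z ^ a ix * cnj z ^ b ix))"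
      unfolding form_def
      by (intro sum.cong refl) (simp add: conj_power_eq a_eq b_eq power_sum)
    then show ?thesis
      using zero by simp
  qed
  then have coeff: "(\<Sum>ix | ix \<in> ?I \<and> a ix = p \<and> b ix = q. T ix) = 0" for p q
    by (intro sum_coefficients_cnj_eq_0) auto
  have "T jx = 0" if jx: "jx \<in> ?I" for jx
  proof -
    let ?G = "{ix. ix \<in> ?I \<and> a ix = a jx \<and> b ix = b jx}"
    \<comment> \<open>Equal exponents force equal multisets in both halves, so \<open>T\<close> is
      constant on \<open>?G\<close> and the coefficient of the monomial is \<open>card ?G\<close>
      times \<open>T jx\<close>.\<close>
    have "T ix = T jx" if ix: "ix \<in> ?G" for ix
    proof (rule cps_tensor_mset[OF T _ jx])
      have len: "length ix = 2 * d" "length jx = 2 * d"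
        using ix jx by (auto simp: multi_indices_def)
      show "mset (take d ix) = mset (take d jx)"
        using ix len by (intro mset_eq_if_power_sums_eq[where M = M]) (auto simp: a_def M_def)
      show "mset (drop d ix) = mset (drop d jx)"
        using ix len by (intro mset_eq_if_power_sums_eq[where M = M]) (auto simp: b_def M_def)
    qed (use ix in auto)
    then have "of_nat (card ?G) * T jx = (\<Sum>ix\<in>?G. T ix)"
      by simp
    also have "\<dots> = 0"
      by (rule coeff)
    finally have "card ?G = 0 \<or> T jx = 0" by simp
    moreover have "finite ?G" "jx \<in> ?G"
      using jx finite_subset[of ?G ?I] by auto
    ultimately show ?thesis by auto
  qed
  moreover have "T jx = 0" if "jx \<notin> ?I" for jx
    using T that by (auto simp: cps_tensors_def ps_tensors_def tensors_def)
  ultimately show False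
    using assms(2) by blast
qed

text \<open>Along the real multiples of a conjugate power the squared distance is a quadratic in the
  multiplier. Its vertex \<open>c / N\<close> lies below the value at 0 by the square of
  \<open>c\<close> divided by \<open>N\<close>.\<close>

lemma exists_closer_than_zero:
  assumes T: "T \<in> cps_tensors n d" and "T \<noteq> (\<lambda>_. 0)"
  shows "\<exists>X\<in>cps_rank_one n d. frob_norm n (2 * d) (T - X) < frob_norm n (2 * d) T"
proof -
  let ?I = "multi_indices n (2 * d)"
  obtain x where "form n d T x \<noteq> 0"
    using form_nonzero[OF assms] by blast
  define c where "c = Re (form n d T x)"
  have form: "form n d T x = complex_of_real c"
    using form_real[OF T] by (simp add: c_def)
  have c: "c \<noteq> 0"
    using \<open>form n d T x \<noteq> 0\<close> form by simp
  let ?P = "conj_power n d x"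
  define N where "N = (\<Sum>ix\<in>?I. (cmod (?P ix))\<^sup>2)"
  obtain jx where jx: "jx \<in> ?I" "?P jx \<noteq> 0"
    using \<open>form n d T x \<noteq> 0\<close> unfolding form_def
    by (metis (no_types, lifting) complex_cnj_zero mult_zero_right sum.neutral)
  then have "N > 0"
    unfolding N_def by (intro sum_pos2[of _ jx]) auto
  let ?X = "\<lambda>ix. complex_of_real (c / N) * ?P ix"
  have pt: "(cmod (t - of_real l * p))\<^sup>2 = (cmod t)\<^sup>2 - 2 * l * Re (t * cnj p) + l\<^sup>2 * (cmod p)\<^sup>2"
    for t p l
    unfolding cmod_power2 by (simp add: power2_eq_square algebra_simps)
  have "(\<Sum>ix\<in>?I. (cmod (T ix - of_real l * ?P ix))\<^sup>2)
      = (\<Sum>ix\<in>?I. (cmod (T ix))\<^sup>2) - 2 * l * c + l\<^sup>2 * N" for l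
    unfolding pt c_def N_def form_def Re_sum
    by (simp only: sum.distrib sum_subtractf sum_distrib_left)
  then have "(\<Sum>ix\<in>?I. (cmod (T ix - ?X ix))\<^sup>2)
      = (\<Sum>ix\<in>?I. (cmod (T ix))\<^sup>2) - 2 * (c / N) * c + (c / N)\<^sup>2 * N" .
  also have "\<dots> = (\<Sum>ix\<in>?I. (cmod (T ix))\<^sup>2) - c\<^sup>2 / N"
    using \<open>N > 0\<close> by (simp add: power2_eq_square)
  also have "\<dots> < (\<Sum>ix\<in>?I. (cmod (T ix))\<^sup>2)"
    using c \<open>N > 0\<close> by simp
  finally have "frob_norm n (2 * d) (T - ?X) < frob_norm n (2 * d) T"
    by (simp add: frob_norm_def)
  moreover have "?X jx \<noteq> 0"
    using jx c \<open>N > 0\<close> by simp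
  then have "?X \<noteq> (\<lambda>_. 0)" by metis
  then have "?X \<in> cps_rank_one n d"
    unfolding cps_rank_one_iff by blast
  ultimately show ?thesis by blast
qed

section \<open>Attainment\<close>

text \<open>Rank-one tensors can tend to 0, so the compact image may contain the zero tensor. The
  competitor \<open>X0\<close> beats 0, hence the minimizer over the image is nonzero, and it also
  beats every tensor farther from \<open>T\<close> than 0 is.\<close>

lemma min_attained_if_compact:
  fixes g :: "'a :: topological_space \<Rightarrow> tensor"
  assumes K: "compact K" "\<And>ix. continuous_on K (\<lambda>k. g k ix)"
    and sub: "g ` K \<subseteq> insert (\<lambda>_. 0) S"
    and bounded: "\<And>X. X \<in> S \<Longrightarrow> frob_norm n m (T - X) \<le> frob_norm n m T \<Longrightarrow> X \<in> g ` K"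
    and closer: "X0 \<in> S" "frob_norm n m (T - X0) < frob_norm n m T"
  shows "min_attained n m T S"
proof -
  have X0: "X0 \<in> g ` K"
    using bounded closer by simp
  have "continuous_on K (\<lambda>k. frob_norm n m (T - g k))"
    unfolding frob_norm_def fun_diff_def by (intro continuous_intros K)
  then obtain k where k: "k \<in> K" "\<And>k'. k' \<in> K \<Longrightarrow> frob_norm n m (T - g k) \<le> frob_norm n m (T - g k')"
    using continuous_attains_inf[OF K(1)] X0 by blast
  have k0: "frob_norm n m (T - g k) \<le> frob_norm n m (T - X0)"
    using k X0 by blast
  have "g k \<noteq> (\<lambda>_. 0)"
    using k0 closer(2) by (auto simp: fun_diff_def)
  then have gk: "g k \<in> S"
    using k(1) sub by blast
  have "frob_norm n m (T - g k) \<le> frob_norm n m (T - X)" if "X \<in> S" for X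
  proof (cases "frob_norm n m (T - X) \<le> frob_norm n m T")
    case True
    then show ?thesis
      using bounded[OF that] k(2) by blast
  next
    case False
    then show ?thesis
      using k0 closer by simp
  qed
  then have "frob_norm n m (T - g k) \<le> min_dist n m T S"
    unfolding min_dist_def using gk by (intro cINF_greatest) auto
  then show ?thesis
    unfolding min_attained_def using gk min_dist_le[OF gk]
    by (intro bexI[of _ "g k"]) (auto intro: antisym)
qed

text \<open>Tychonoff's theorem: vectors are functions on all naturals, so the parameter sets are
  infinite products.\<close>

lemma compact_box:
  fixes C :: "'b :: topological_space set"
  assumes "compact C"
  shows "compact {x :: 'a \<Rightarrow> 'b. \<forall>i. x i \<in> C}"
proof -
  have "compactin (product_topology (\<lambda>_. euclidean) UNIV) (PiE UNIV (\<lambda>_. C) :: ('a \<Rightarrow> 'b) set)"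
    unfolding compactin_PiE using assms by simp
  then have "compact (PiE UNIV (\<lambda>_. C) :: ('a \<Rightarrow> 'b) set)"
    by (simp add: euclidean_product_topology)
  moreover have "PiE UNIV (\<lambda>_. C) = {x :: 'a \<Rightarrow> 'b. \<forall>i. x i \<in> C}"
    by auto
  ultimately show ?thesis by simp
qed

text \<open>Division by an entry of largest modulus. The resulting entry 1 later exhibits the
  coefficient of a rank-one tensor as one of its entries.\<close>

lemma normalize_vector:
  fixes x :: "nat \<Rightarrow> complex"
  assumes "\<exists>i<n. x i \<noteq> 0"
  obtains c y j where "j < n" "y j = 1" "\<And>i. y i \<in> cball 0 1" "\<And>i. i < n \<Longrightarrow> x i = c * y i"
proof -
  obtain j where j: "j < n" "\<And>i. i < n \<Longrightarrow> cmod (x i) \<le> cmod (x j)"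
  proof -
    have "finite ((\<lambda>i. cmod (x i)) ` {..<n})" "(\<lambda>i. cmod (x i)) ` {..<n} \<noteq> {}"
      using assms by auto
    from Max_in[OF this] Max_ge[OF this(1)] show ?thesis
      using that by fastforce
  qed
  have nz: "x j \<noteq> 0"
    using assms j by fastforce
  \<comment> \<open>The value 0 beyond \<open>n\<close> keeps \<open>y\<close> in the box without
    affecting the tensor.\<close>
  define y where "y i = (if i < n then x i / x j else 0)" for i
  have "y j = 1" "\<And>i. y i \<in> cball 0 1" "\<And>i. i < n \<Longrightarrow> x i = x j * y i"
    using j nz by (auto simp: y_def norm_divide)
  with j(1) show ?thesis
    by (rule that)
qed

lemma coefficient_bound:
  assumes "ix \<in> multi_indices n m" "frob_norm n m (T - X) \<le> frob_norm n m T"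
  shows "cmod (X ix) \<le> 2 * frob_norm n m T"
proof -
  have "cmod (X ix) \<le> cmod (T ix) + cmod ((T - X) ix)"
    using norm_triangle_ineq4[of "T ix" "(T - X) ix"] by simp
  then show ?thesis
    using cmod_le_frob_norm[OF assms(1), of T] cmod_le_frob_norm[OF assms(1), of "T - X"] assms(2)
    by linarith
qed

text \<open>All scaling is moved into one coefficient \<open>l\<close>, leaving factors in the unit
  box; \<open>coefficient_bound\<close> then confines \<open>l\<close> to a disc.\<close>

lemma min_attained_rank_one:
  assumes "m \<ge> 1" and closer: "X0 \<in> rank_one n m" "frob_norm n m (T - X0) < frob_norm n m T"
  shows "min_attained n m T (rank_one n m)"
proof -
  define K where "K = cball (0 :: complex) (2 * frob_norm n m T) \<times>
    {a. \<forall>k :: nat. a k \<in> {y. \<forall>i :: nat. y i \<in> cball (0 :: complex) 1}}"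
  define g where "g = (\<lambda>(l, a) ix. l * outer_prod n m a ix)"
  show ?thesis
  proof (rule min_attained_if_compact[OF _ _ _ _ closer])
    show "compact K"
      unfolding K_def by (rule compact_Times[OF compact_cball compact_box[OF compact_box[OF compact_cball]]])
    show "continuous_on K (\<lambda>k. g k ix)" for ix
    proof -
      have "continuous_on K (\<lambda>p. snd p k i)" for k i
        by (rule continuous_on_product_then_coordinatewise
            [OF continuous_on_product_then_coordinatewise[OF continuous_on_snd[OF continuous_on_id]]])
      then show ?thesis
        unfolding g_def outer_prod_def case_prod_beta
        by (cases "ix \<in> multi_indices n m") 
             (simp_all add: continuous_on_mult continuous_on_prod continuous_on_fst)
    qed
    show "g ` K \<subseteq> insert (\<lambda>_. 0) (rank_one n m)"
      using assms(1) by (auto simp: g_def rank_one_iff scaled_outer_prod)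
    fix X assume "X \<in> rank_one n m" and le: "frob_norm n m (T - X) \<le> frob_norm n m T"
    then obtain a where X: "X = outer_prod n m a" "X \<noteq> (\<lambda>_. 0)"
      by (auto simp: rank_one_iff)
    then obtain ix where ix: "ix \<in> multi_indices n m" "\<And>k. k < m \<Longrightarrow> a k (ix ! k) \<noteq> 0"
      by (auto simp: outer_prod_def fun_eq_iff split: if_splits)
    have "\<exists>c y j. j < n \<and> y j = 1 \<and> (\<forall>i. y i \<in> cball 0 1) \<and> (\<forall>i<n. a k i = c * y i)" if "k < m" for k
      using normalize_vector[of n "a k"] ix(2)[OF that] multi_indices_nth[OF ix(1) that] by metis
    then obtain c y j where y: "\<And>k. k < m \<Longrightarrow> j k < n \<and> y k (j k) = 1 \<and>
        (\<forall>i. y k i \<in> cball 0 1) \<and> (\<forall>i<n. a k i = c k * y k i)"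
      by metis
    let ?y = "\<lambda>k. if k < m then y k else (\<lambda>_. 0)"
    let ?l = "\<Prod>k<m. c k"
    have Xg: "X = g (?l, ?y)"
    proof
      fix ix show "X ix = g (?l, ?y) ix"
        using y by (auto simp: X(1) g_def outer_prod_def multi_indices_nth
            simp flip: prod.distrib intro!: prod.cong)
    qed
    \<comment> \<open>At the positions of the unit entries the product of the normalized factors is
      1, so this entry of \<open>X\<close> is the coefficient itself.\<close>
    let ?j = "map j [0..<m]"
    have "?j \<in> multi_indices n m"
      using y by (auto simp: multi_indices_def)
    moreover from this have "X ?j = ?l"
      unfolding Xg using y by (simp add: g_def outer_prod_def)
    ultimately have "cmod ?l \<le> 2 * frob_norm n m T"
      using coefficient_bound[OF _ le] by metis
    then have "(?l, ?y) \<in> K"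
      using y by (auto simp: K_def)
    then show "X \<in> g ` K"
      using Xg by blast
  qed
qed

text \<open>The same compactness argument with a single vector and a real coefficient.\<close>

lemma min_attained_cps:
  assumes closer: "X0 \<in> cps_rank_one n d" "frob_norm n (2 * d) (T - X0) < frob_norm n (2 * d) T"
    and "d \<ge> 1"
  shows "min_attained n (2 * d) T (cps_rank_one n d)"
proof -
  let ?B = "2 * frob_norm n (2 * d) T"
  define K where "K = cball (0 :: real) ?B \<times> {y. \<forall>i :: nat. y i \<in> cball (0 :: complex) 1}"
  define g where "g = (\<lambda>(l, y) ix. complex_of_real l * conj_power n d y ix)"
  show ?thesis
  proof (rule min_attained_if_compact[OF _ _ _ _ closer])
    show "compact K"
      unfolding K_def by (rule compact_Times[OF compact_cball compact_box[OF compact_cball]])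
    show "continuous_on K (\<lambda>k. g k ix)" for ix
    proof (cases "ix \<in> multi_indices n (2 * d)")
      case True
      have "continuous_on K (\<lambda>p. snd p i)" for i
        by (rule continuous_on_product_then_coordinatewise[OF continuous_on_snd[OF continuous_on_id]])
      then show ?thesis
        unfolding g_def case_prod_beta conj_power_eq[OF True]
        by (intro continuous_on_mult continuous_on_prod continuous_on_cnj continuous_on_of_real
            continuous_on_fst continuous_on_id)
    qed (simp add: g_def case_prod_beta conj_power_outside)
    show "g ` K \<subseteq> insert (\<lambda>_. 0) (cps_rank_one n d)"
      unfolding g_def cps_rank_one_iff image_subset_iff case_prod_beta insert_iff by blast
    fix X assume "X \<in> cps_rank_one n d" and le: "frob_norm n (2 * d) (T - X) \<le> frob_norm n (2 * d) T"
    then obtain l x where X: "X = (\<lambda>ix. complex_of_real l * conj_power n d x ix)" "X \<noteq> (\<lambda>_. 0)"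
      by (auto simp: cps_rank_one_iff)
    then obtain ix where "conj_power n d x ix \<noteq> 0"
      by (metis mult_zero_right)
    moreover from this have "ix \<in> multi_indices n (2 * d)"
      by (metis conj_power_outside)
    ultimately have ix: "ix \<in> multi_indices n (2 * d)" "x (ix ! 0) \<noteq> 0"
      using \<open>d \<ge> 1\<close> by (auto simp: conj_power_eq)
    then have "\<exists>i<n. x i \<noteq> 0"
      using multi_indices_nth[OF ix(1), of 0] \<open>d \<ge> 1\<close> by auto
    then obtain c y j where y: "j < n" "y j = 1" "\<And>i. y i \<in> cball 0 1" "\<And>i. i < n \<Longrightarrow> x i = c * y i"
      by (rule normalize_vector) (rule that)
    \<comment> \<open>Normalizing extracts \<open>c\<close> from \<open>d\<close> plain and
      \<open>d\<close> conjugated factors, so the new coefficient stays real.\<close>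
    let ?l = "l * (cmod c ^ d)\<^sup>2"
    have c: "cnj (c ^ d) * c ^ d = complex_of_real ((cmod c ^ d)\<^sup>2)"
      using complex_norm_square[of "c ^ d"] by (simp add: norm_power mult.commute)
    have Xg: "X = g (?l, y)"
    proof
      fix ix
      show "X ix = g (?l, y) ix"
      proof (cases "ix \<in> multi_indices n (2 * d)")
        case True
        have "conj_power n d x ix = cnj (\<Prod>k<d. c * y (ix ! k)) * (\<Prod>k<d. c * y (ix ! (d + k)))"
          unfolding conj_power_eq[OF True]
          using multi_indices_nth[OF True] y(4) by simp
        also have "\<dots> = (cnj (c ^ d) * c ^ d) * conj_power n d y ix"
          by (simp add: conj_power_eq[OF True] prod.distrib)
        finally show ?thesis
          by (simp only: X(1) g_def c) simp
      qed (simp add: X(1) g_def conj_power_outside)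
    qed
    let ?j = "replicate (2 * d) j"
    have "?j \<in> multi_indices n (2 * d)"
      using y by (auto simp: multi_indices_def)
    moreover from this have "X ?j = complex_of_real ?l"
      unfolding Xg using y by (simp add: g_def conj_power_eq)
    ultimately have "cmod (complex_of_real ?l) \<le> ?B"
      using coefficient_bound[OF _ le] by metis
    then have "\<bar>?l\<bar> \<le> ?B"
      unfolding norm_of_real .
    then have "(?l, y) \<in> K"
      using y by (simp add: K_def)
    then show "X \<in> g ` K"
      using Xg by blast
  qed
qed

text \<open>The CPS minimizer also serves the PS problem, since the two minimal distances agree. The
  tensor beating 0 has rank one in the general sense too, which settles the third case.\<close>

lemma attained_all:
  assumes "n \<ge> 1" "d \<ge> 1" and T: "T \<in> cps_tensors n d" "T \<noteq> (\<lambda>_. 0)"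
  shows "min_attained n (2 * d) T (cps_rank_one n d)"
    and "min_attained n (2 * d) T (ps_rank_one n d)"
    and "min_attained n (2 * d) T (rank_one n (2 * d))"
proof -
  obtain X where X: "X \<in> cps_rank_one n d" "frob_norm n (2 * d) (T - X) < frob_norm n (2 * d) T"
    using exists_closer_than_zero[OF T] by blast
  show cps: "min_attained n (2 * d) T (cps_rank_one n d)"
    using min_attained_cps[OF X] assms(2) by simp
  then show "min_attained n (2 * d) T (ps_rank_one n d)"
    using cps_rank_one_subset
    unfolding min_attained_def min_dist_cps_eq_ps[OF assms(1) T(1)] by blast
  have "X \<in> rank_one n (2 * d)"
    using X(1) cps_rank_one_subset ps_rank_one_subset[OF assms(2)] by blast
  then show "min_attained n (2 * d) T (rank_one n (2 * d))"
    using min_attained_rank_one X(2) assms(2) by simp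
qed

section \<open>An example with strict inequality\<close>

definition gap_tensor :: tensor where
  "gap_tensor = (\<lambda>ix. if ix = [0, 0, 1, 1] \<or> ix = [1, 1, 0, 0] then 1 else 0)"

lemma gap_tensor_cps: "gap_tensor \<in> cps_tensors 2 2"
proof -
  have perm: "permute_list p ix = ix"
    if p: "p permutes {..<2} \<or> p permutes {2..<4}" and ix: "ix = [a, a, b, b]" for p ix and a b :: nat
  proof (rule nth_equalityI)
    have p4: "p permutes {..<length ix}"
      using p ix by (auto intro: permutes_subset)
    fix k assume "k < length (permute_list p ix)"
    then have k: "k < 4" by (simp add: ix)
    have "ix ! p k = ix ! k"
      using p
    proof
      assume q: "p permutes {..<2}"
      show ?thesis
      proof (cases "k < 2")
        case True
        then have "p k < 2"
          using permutes_in_image[OF q, of k] by simp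
        then show ?thesis
          using True by (auto simp: ix less_2_cases_iff)
      qed (use permutes_not_in[OF q, of k] in simp)
    next
      assume q: "p permutes {2..<4}"
      show ?thesis
      proof (cases "k < 2")
        case False
        then have "p k \<in> {2..<4}"
          using permutes_in_image[OF q, of k] k by simp
        then have "p k = 2 \<or> p k = 3" "k = 2 \<or> k = 3"
          using False k by auto
        then show ?thesis
          by (auto simp: ix numeral_eq_Suc)
      qed (use permutes_not_in[OF q, of k] in simp)
    qed
    then show "permute_list p ix ! k = ix ! k"
      using permute_list_nth[OF p4, of k] k by (simp add: ix)
  qed simp
  \<comment> \<open>Permuted indices must avoid the support whenever the original ones do; the
    inverse permutation reduces this to \<open>perm\<close>.\<close>
  have eq: "permute_list p ix = [a, a, b, b] \<longleftrightarrow> ix = [a, a, b, b]"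
    if p: "p permutes {..<2} \<or> p permutes {2..<4}" and len: "length ix = 4" for p ix and a b :: nat
  proof
    assume *: "permute_list p ix = [a, a, b, b]"
    have p4: "p permutes {..<length ix}"
      using p len by (auto intro: permutes_subset)
    have inv: "inv p permutes {..<2} \<or> inv p permutes {2..<4}"
      using p permutes_inv by blast
    have "ix = permute_list (p \<circ> inv p) ix"
      using permutes_inv_o(1)[OF p4] by simp
    also have "\<dots> = permute_list (inv p) (permute_list p ix)"
      using permute_list_compose[OF permutes_inv[OF p4]] by simp
    also have "\<dots> = [a, a, b, b]"
      using perm[OF inv *] * by simp
    finally show "ix = [a, a, b, b]" .
  qed (use perm[OF p] in simp)
  have swap: "swap_halves 2 ix = [a, a, b, b] \<longleftrightarrow> ix = [b, b, a, a]" if "length ix = 4" for ix and a b :: nat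
    using that by (auto simp: length_Suc_conv numeral_eq_Suc)
  show ?thesis
    using eq swap
    by (auto simp: cps_tensors_def ps_tensors_def tensors_def gap_tensor_def multi_indices_def)
qed

text \<open>Each unit entry alone is a rank-one tensor, and subtracting one of them leaves a single
  entry of modulus 1.\<close>

lemma gap_tensor_rank_one_close: "min_dist 2 4 gap_tensor (rank_one 2 4) \<le> 1"
proof -
  define a :: "nat \<Rightarrow> nat \<Rightarrow> complex" where "a k i = of_bool (i = (if k < 2 then 0 else 1))" for k i
  have outer: "outer_prod 2 4 a = (\<lambda>ix. of_bool (ix = [0, 0, 1, 1]))"
  proof
    fix ix
    have "(\<Prod>k<4. a k (ix ! k)) = of_bool (ix = [0, 0, 1, 1])" if "length ix = 4"
    proof -
      have "\<exists>i j k l. ix = [i, j, k, l]"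
        using that by (auto simp: length_Suc_conv numeral_eq_Suc)
      then show ?thesis
        by (auto simp: a_def numeral_eq_Suc)
    qed
    then show "outer_prod 2 4 a ix = of_bool (ix = [0, 0, 1, 1])"
      by (auto simp: outer_prod_def multi_indices_def)
  qed
  have "outer_prod 2 4 a [0, 0, 1, 1] \<noteq> 0"
    unfolding outer by simp
  then have "outer_prod 2 4 a \<in> rank_one 2 4"
    unfolding rank_one_iff by fastforce
  then have "min_dist 2 4 gap_tensor (rank_one 2 4) \<le> frob_norm 2 4 (gap_tensor - outer_prod 2 4 a)"
    by (rule min_dist_le)
  also have "\<dots> = sqrt (\<Sum>ix\<in>multi_indices 2 4. of_bool (ix = [1, 1, 0, 0]))"
    unfolding frob_norm_def outer by (intro arg_cong[of _ _ sqrt] sum.cong) (auto simp: gap_tensor_def)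
  also have "\<dots> = 1"
  proof -
    have "[1, 1, 0, 0] \<in> multi_indices 2 4"
      by (simp add: multi_indices_def)
    then show ?thesis
      by (simp add: of_bool_def)
  qed
  finally show ?thesis .
qed

text \<open>The six entries with two zeros and two ones already suffice: with \<open>w\<close> the entry of the
  approximating tensor at \<open>[0, 0, 1, 1]\<close>, they contribute
  \<open>2 * (cmod (1 - w))\<^sup>2 + 4 * (cmod w)\<^sup>2\<close>, which is at least \<open>4 / 3\<close>.\<close>

lemma gap_tensor_cps_rank_one_far:
  assumes "X \<in> cps_rank_one 2 2"
  shows "frob_norm 2 4 (gap_tensor - X) > 1"
proof -
  obtain l x where X: "X = (\<lambda>ix. complex_of_real l * conj_power 2 2 x ix)"
    using assms by (auto simp: cps_rank_one_iff)
  define w where "w = complex_of_real l * (cnj (x 0) ^ 2 * x 1 ^ 2)"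
  let ?J = "{[0, 0, 1, 1], [1, 1, 0, 0], [0, 1, 0, 1], [0, 1, 1, 0], [1, 0, 0, 1], [1, 0, 1, 0 :: nat]}"
  let ?f = "\<lambda>ix. (cmod (gap_tensor ix - X ix))\<^sup>2"
  have J: "?J \<subseteq> multi_indices 2 4"
    by (auto simp: multi_indices_def)
  have Xe: "X [i, j, p, q] = complex_of_real l * (cnj (x i * x j) * (x p * x q))"
    if "[i, j, p, q] \<in> multi_indices 2 4" for i j p q
    using that by (simp add: X conj_power_eq numeral_eq_Suc)
  have w: "cmod w = \<bar>l\<bar> * ((cmod (x 0))\<^sup>2 * (cmod (x 1))\<^sup>2)"
    by (simp add: w_def norm_mult norm_power)
  have "?f [0, 0, 1, 1] = (cmod (1 - w))\<^sup>2"
    using J by (simp add: Xe gap_tensor_def w_def power2_eq_square)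
  moreover have "?f [1, 1, 0, 0] = (cmod (1 - w))\<^sup>2"
  proof -
    have "?f [1, 1, 0, 0] = (cmod (cnj (1 - w)))\<^sup>2"
      using J by (simp add: Xe gap_tensor_def w_def power2_eq_square mult_ac
          del: complex_cnj_diff complex_mod_cnj) (simp add: mult_ac)
    then show ?thesis
      by (simp only: complex_mod_cnj)
  qed
  \<comment> \<open>Here each half contains one 0 and one 1, so the entry of \<open>X\<close> has
    the same modulus as \<open>w\<close>, while \<open>gap_tensor\<close> vanishes.\<close>
  moreover have "?f [0, 1, 0, 1] = (cmod w)\<^sup>2" "?f [0, 1, 1, 0] = (cmod w)\<^sup>2"
    "?f [1, 0, 0, 1] = (cmod w)\<^sup>2" "?f [1, 0, 1, 0] = (cmod w)\<^sup>2"
    unfolding w using J by (simp_all add: Xe gap_tensor_def norm_mult power2_eq_square mult_ac)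
  ultimately have "sum ?f ?J = 2 * (cmod (1 - w))\<^sup>2 + 4 * (cmod w)\<^sup>2"
    by simp
  \<comment> \<open>Completing the square; the minimum is at \<open>w = 1 / 3\<close>.\<close>
  also have "\<dots> = 4 / 3 + 6 * (Re w - 1 / 3)\<^sup>2 + 6 * (Im w)\<^sup>2"
    unfolding cmod_power2 by (simp add: power2_eq_square algebra_simps)
  also have "1 < 4 / 3 + 6 * (Re w - 1 / 3)\<^sup>2 + 6 * (Im w)\<^sup>2"
    by (rule less_le_trans[of _ "4 / 3"]) auto
  finally have "1 < sum ?f ?J" .
  also have "sum ?f ?J \<le> sum ?f (multi_indices 2 4)"
    using J by (intro sum_mono2) auto
  finally show ?thesis
    by (simp add: frob_norm_def)
qed

theorem theorem4p4:
  "(\<forall>n d T. n \<ge> 1 \<and> d \<ge> 2 \<and> T \<in> cps_tensors n d \<longrightarrow>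
      min_dist n (2 * d) T (cps_rank_one n d) = min_dist n (2 * d) T (ps_rank_one n d) \<and>
      min_dist n (2 * d) T (ps_rank_one n d) \<ge> min_dist n (2 * d) T (rank_one n (2 * d)) \<and>
      (T \<noteq> (\<lambda>_. 0) \<longrightarrow>
        min_attained n (2 * d) T (cps_rank_one n d) \<and>
        min_attained n (2 * d) T (ps_rank_one n d) \<and>
        min_attained n (2 * d) T (rank_one n (2 * d)))) \<and>
   (\<exists>n d T. n \<ge> 1 \<and> d \<ge> 2 \<and> T \<in> cps_tensors n d \<and>
      min_attained n (2 * d) T (cps_rank_one n d) \<and>
      min_attained n (2 * d) T (rank_one n (2 * d)) \<and>
      min_dist n (2 * d) T (cps_rank_one n d) > min_dist n (2 * d) T (rank_one n (2 * d)))"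
proof (intro conjI allI impI; (elim conjE)?)
  fix n d :: nat and T
  assume nd: "n \<ge> 1" "d \<ge> 2" and T: "T \<in> cps_tensors n d"
  show "min_dist n (2 * d) T (cps_rank_one n d) = min_dist n (2 * d) T (ps_rank_one n d)"
    using nd(1) T by (rule min_dist_cps_eq_ps)
  show "min_dist n (2 * d) T (ps_rank_one n d) \<ge> min_dist n (2 * d) T (rank_one n (2 * d))"
    using cps_rank_one_nonempty[OF nd(1)] cps_rank_one_subset ps_rank_one_subset nd
    by (intro min_dist_mono) (simp, blast)
  assume "T \<noteq> (\<lambda>_. 0)"
  with nd T show "min_attained n (2 * d) T (cps_rank_one n d)"
    "min_attained n (2 * d) T (ps_rank_one n d)" "min_attained n (2 * d) T (rank_one n (2 * d))"
    using attained_all[of n d T] by simp_all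
next
  have "gap_tensor [0, 0, 1, 1] \<noteq> 0"
    by (simp add: gap_tensor_def)
  then have "gap_tensor \<noteq> (\<lambda>_. 0)" by metis
  then have att: "min_attained 2 (2 * 2) gap_tensor (cps_rank_one 2 2)"
      "min_attained 2 (2 * 2) gap_tensor (rank_one 2 (2 * 2))"
    using attained_all[of 2 2 gap_tensor] gap_tensor_cps by simp_all
  \<comment> \<open>Attainment carries the strict bound for each competitor over to the
    infimum.\<close>
  have "min_dist 2 (2 * 2) gap_tensor (cps_rank_one 2 2) > 1"
    using att(1) gap_tensor_cps_rank_one_far unfolding min_attained_def by fastforce
  then have "min_dist 2 (2 * 2) gap_tensor (cps_rank_one 2 2)
      > min_dist 2 (2 * 2) gap_tensor (rank_one 2 (2 * 2))"
    using gap_tensor_rank_one_close by simp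
  with att gap_tensor_cps show "\<exists>n d T. n \<ge> 1 \<and> d \<ge> 2 \<and> T \<in> cps_tensors n d \<and>
      min_attained n (2 * d) T (cps_rank_one n d) \<and>
      min_attained n (2 * d) T (rank_one n (2 * d)) \<and>
      min_dist n (2 * d) T (cps_rank_one n d) > min_dist n (2 * d) T (rank_one n (2 * d))"
    by (intro exI[of _ 2] exI[of _ gap_tensor]) auto
qed

end
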